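(* For all integers $n\ge k\ge 0$, $$B_{n,k}\Big(H_{1,\lambda}^{Y}(x),H_{2,\lambda}^{Y}(x),\dots,H_{n-k+1,\lambda}^{Y}(x)\Big)= \sum_{j=k}^{n}{j \brace k}H_{\lambda}^{Y}(n,j)x^{j}.$$
   Context: Let $Y$ be a real random variable with $E[|Y|^{n}]<\infty$ for all integers $n\ge 0$ and $\lim_{n\to\infty}|t|^{n}E[|Y|^{n}]/n!=0$ for $|t|<r$, for some $r>0$. Fix a nonzero real $\lambda$. Put $\langle x\rangle_{0,\lambda}=1$, $\langle x\rangle_{n,\lambda}=x(x+\lambda)\cdots(x+(n-1)\lambda)$, and $e_\lambda^{-Y}(-t)=(1-\lambda t)^{-Y/\lambda}$, so $E[e_\lambda^{-Y}(-t)]=\sum_{n\ge0}E[\langle Y\rangle_{n,\lambda}]t^n/n!$ near $t=0$. The probabilistic heterogeneous Stirling numbers of the second kind are defined by $\frac{1}{k!}(E[e_{\lambda}^{-Y}(-t)]-1)^{k}=\sum_{n\ge k}H_{\lambda}^{Y}(n,k)t^{n}/n!$, and the probabilistic heterogeneous Bell polynomials by $e^{x(E[e_{\lambda}^{-Y}(-t)]-1)}=\sum_{n\ge0}H_{n,\lambda}^{Y}(x)t^{n}/n!$. ${j\brace k}$ are the (classical) Stirling numbers of the second kind, $\frac1{k!}(e^t-1)^k=\sum_{n\ge k}{n\brace k}t^n/n!$. The partial Bell polynomials $B_{n,k}$ are defined by $\frac{1}{k!}\big(\sum_{m\ge1}x_{m}\frac{t^{m}}{m!}\big)^{k}=\sum_{n\ge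 k}B_{n,k}(x_{1},\dots,x_{n-k+1})\frac{t^{n}}{n!}$. *)

theory Defs
  imports
    "HOL-Probability.Probability"
    "HOL-Complex_Analysis.Complex_Analysis"
    "HOL-Combinatorics.Stirling"
begin

text \<open>
  \<open>egf_coeff f n\<close> is the number \<open>a n\<close> determined by
  \<open>f t = (\<Sum>n. a n * t ^ n / fact n)\<close> for all \<open>t\<close> near \<open>0\<close>. By the lemma
  \<open>egf_coeff_eqI\<close> below the power series is unique whenever it exists.
\<close>

definition egf_coeff :: "(real \<Rightarrow> real) \<Rightarrow> nat \<Rightarrow> real" where
  "egf_coeff f n = fact n * fps_nth (THE F. f has_fps_expansion F) n"

lemma has_fps_expansion_unique_real:
  fixes f :: "real \<Rightarrow> real"
  assumes F: "f has_fps_expansion F" and G: "f has_fps_expansion G"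
  shows "F = G"
proof (rule ccontr)
  assume "F \<noteq> G"
  define D where "D = F - G"
  have D: "(\<lambda>_. 0) has_fps_expansion D"
    using has_fps_expansion_diff[OF F G] by (simp add: D_def)
  then have rad: "fps_conv_radius D > 0"
    and ev: "eventually (\<lambda>z. eval_fps D z = 0) (nhds 0)"
    by (auto simp: has_fps_expansion_def)
  have at0: "eval_fps D 0 = 0"
    using ev by (rule eventually_nhds_x_imp_x)
  from \<open>F \<noteq> G\<close> obtain m where m: "fps_nth D m \<noteq> 0"
    by (auto simp: D_def fps_eq_iff)
  have "m > 0"
    using m at0 by (cases m) (auto simp: eval_fps_at_0)
  obtain r where r: "0 < r" "ereal r < fps_conv_radius D"
    using rad ereal_dense2[of 0 "fps_conv_radius D"] by (auto simp: zero_ereal_def)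
  have sums: "(\<lambda>n. fps_nth D n * (x - 0) ^ n) sums eval_fps D x" if "norm (x - 0) < r" for x
  proof -
    have "ereal (norm x) < ereal r"
      using that by simp
    then have "ereal (norm x) < fps_conv_radius D"
      using r(2) by (rule order.strict_trans)
    then show ?thesis
      using sums_eval_fps[of x D] by simp
  qed
  obtain s where s: "0 < s" "\<And>z. z \<in> cball 0 s - {0} \<Longrightarrow> eval_fps D z \<noteq> 0"
    using powser_0_nonzero[OF r(1) sums at0 m \<open>m > 0\<close>] by blast
  obtain e where e: "e > 0" "\<And>z. dist z 0 < e \<Longrightarrow> eval_fps D z = 0"
    using ev by (auto simp: eventually_nhds_metric)
  define z where "z = min s (e / 2)"
  have z: "0 < z" "z \<le> s" "z < e"
    using s(1) e(1) by (auto simp: z_def)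
  show False
    using s(2)[of z] e(2)[of z] z by simp
qed

lemma egf_coeff_eqI:
  assumes "f has_fps_expansion F"
  shows "egf_coeff f n = fact n * fps_nth F n"
proof -
  have "(THE F. f has_fps_expansion F) = F"
  proof (rule the_equality)
    show "f has_fps_expansion F"
      by (fact assms)
    show "G = F" if "f has_fps_expansion G" for G
      using that assms by (rule has_fps_expansion_unique_real)
  qed
  then show ?thesis
    by (simp add: egf_coeff_def)
qed

text \<open>
  The expectation of \<open>e\<^sub>\<lambda>\<^bsup>-Y\<^esup>(-t) = (1 - \<lambda>t)\<^bsup>-Y/\<lambda>\<^esup>\<close>; it is meaningful for \<open>t\<close> near \<open>0\<close>,
  where \<open>1 - \<lambda>t > 0\<close>.
\<close>

definition het_mgf :: "'a measure \<Rightarrow> ('a \<Rightarrow> real) \<Rightarrow> real \<Rightarrow> real \<Rightarrow> real" where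
  "het_mgf M Y lam t = (\<integral>\<omega>. (1 - lam * t) powr (- Y \<omega> / lam) \<partial>M)"

definition het_stirling2 ::
  "'a measure \<Rightarrow> ('a \<Rightarrow> real) \<Rightarrow> real \<Rightarrow> nat \<Rightarrow> nat \<Rightarrow> real" where
  "het_stirling2 M Y lam n k = egf_coeff (\<lambda>t. 1 / fact k * (het_mgf M Y lam t - 1) ^ k) n"

definition het_bell ::
  "'a measure \<Rightarrow> ('a \<Rightarrow> real) \<Rightarrow> real \<Rightarrow> nat \<Rightarrow> real \<Rightarrow> real" where
  "het_bell M Y lam n x = egf_coeff (\<lambda>t. exp (x * (het_mgf M Y lam t - 1))) n"

text \<open>
  The variables \<open>x\<^sub>1, x\<^sub>2, \<dots>\<close> are passed as a sequence, whose entry at \<open>0\<close> is ignored; only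
  \<open>x\<^sub>1, \<dots>, x\<^bsub>n-k+1\<^esub>\<close> matter, see \<open>partial_bell_cong\<close>.
\<close>

definition partial_bell :: "nat \<Rightarrow> nat \<Rightarrow> (nat \<Rightarrow> 'a::field_char_0) \<Rightarrow> 'a" where
  "partial_bell n k x =
     fact n * fps_nth (fps_const (1 / fact k) *
       Abs_fps (\<lambda>m. if m = 0 then 0 else x m / fact m) ^ k) n"

lemma fps_nth_power_cong:
  fixes F G :: "'a::comm_ring_1 fps"
  assumes "\<And>i. i \<le> N \<Longrightarrow> fps_nth F i = fps_nth G i" and "j \<le> N"
  shows "fps_nth (F ^ k) j = fps_nth (G ^ k) j"
  using assms(2)
proof (induction k arbitrary: j)
  case (Suc k)
  then show ?case
    using assms(1) by (auto simp: fps_mult_nth intro!: sum.cong)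
qed simp

lemma partial_bell_cong:
  fixes x y :: "nat \<Rightarrow> 'a::field_char_0"
  assumes "k \<le> n" and "\<And>m. m \<in> {1..n - k + 1} \<Longrightarrow> x m = y m"
  shows "partial_bell n k x = partial_bell n k y"
proof -
  define T where "T z = Abs_fps (\<lambda>m. z (Suc m) / fact (Suc m))" for z :: "nat \<Rightarrow> 'a"
  have *: "Abs_fps (\<lambda>m. if m = 0 then 0 else z m / fact m) = fps_X * T z" for z :: "nat \<Rightarrow> 'a"
    by (rule fps_ext) (auto simp: T_def simp del: fact_Suc)
  have "fps_nth (T x ^ k) (n - k) = fps_nth (T y ^ k) (n - k)"
    by (rule fps_nth_power_cong[of "n - k"]) (auto simp: T_def assms(2))
  then show ?thesis
    using assms(1) by (simp add: partial_bell_def * power_mult_distrib fps_X_power_mult_nth)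
qed

end

theory Submission
  imports Defs
begin

text \<open>
  Substituting \<open>s = -ln (1 - \<lambda>t) / \<lambda>\<close> turns \<open>E[(1 - \<lambda>t)\<^bsup>-Y/\<lambda>\<^esup>]\<close> into the moment generating
  function \<open>E[exp (sY)]\<close>, which the moment condition makes analytic at \<open>0\<close>. Hence
  \<open>E[(1 - \<lambda>t)\<^bsup>-Y/\<lambda>\<^esup>] - 1\<close> is given near \<open>0\<close> by a power series \<open>F\<close> without constant term.
  The generating function of the Bell polynomials is the composition of \<open>exp (xX)\<close> with \<open>F\<close>, so the
  partial Bell polynomial is read off from the composition of \<open>(exp (xX) - 1)^k / k!\<close> with \<open>F\<close>, and
  the coefficients of the outer series are Stirling numbers.
\<close>

section \<open>Composition of real power series expansions\<close>

text \<open>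
  The library composes expansions of complex functions only; the real case follows by
  complexifying the coefficients.
\<close>

definition fps_complex_of_real :: "real fps \<Rightarrow> complex fps" where
  "fps_complex_of_real F = Abs_fps (\<lambda>n. complex_of_real (fps_nth F n))"

lemma fps_nth_complex_of_real [simp]:
  "fps_nth (fps_complex_of_real F) n = of_real (fps_nth F n)"
  by (simp add: fps_complex_of_real_def)

lemma fps_complex_of_real_mult:
  "fps_complex_of_real (F * G) = fps_complex_of_real F * fps_complex_of_real G"
  by (rule fps_ext) (simp add: fps_mult_nth)

lemma fps_complex_of_real_power:
  "fps_complex_of_real (F ^ k) = fps_complex_of_real F ^ k"
proof (induction k)
  case 0
  show ?case by (rule fps_ext) simp
next
  case (Suc k)
  then show ?case by (simp add: fps_complex_of_real_mult)
qed

lemma fps_complex_of_real_compose: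
  "fps_complex_of_real (F oo G) = fps_complex_of_real F oo fps_complex_of_real G"
  by (rule fps_ext) (simp add: fps_compose_nth flip: fps_complex_of_real_power)

lemma fps_conv_radius_complex_of_real [simp]:
  "fps_conv_radius (fps_complex_of_real F) = fps_conv_radius F"
  by (simp add: fps_conv_radius_def conv_radius_def)

lemma eval_fps_complex_of_real:
  assumes "ereal \<bar>x\<bar> < fps_conv_radius F"
  shows "eval_fps (fps_complex_of_real F) (of_real x) = of_real (eval_fps F x)"
proof -
  have "(\<lambda>n. of_real (fps_nth F n * x ^ n)) sums complex_of_real (eval_fps F x)"
    using sums_eval_fps[of x F] assms by (intro sums_of_real) simp
  then show ?thesis
    by (simp add: eval_fps_def sums_iff)
qed

text \<open>Used for \<open>g\<close> the identity or the inner function of a composition: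
  continuity and \<open>g 0 = 0\<close> pull the disc of convergence back to a neighbourhood of
  0.\<close>

lemma eventually_abs_less_conv_radius:
  assumes "fps_conv_radius F > 0" and "isCont g 0" and "g 0 = (0::real)"
  shows "eventually (\<lambda>t. ereal \<bar>g t\<bar> < fps_conv_radius F) (nhds 0)"
proof -
  have "filterlim g (nhds 0) (nhds 0)"
    using tendsto_at_iff_tendsto_nhds[of g 0] assms(2,3) by (simp add: isCont_def)
  moreover have "eventually (\<lambda>z. z \<in> eball 0 (fps_conv_radius F)) (nhds (0::real))"
    using assms(1) by (intro eventually_nhds_in_open) (auto simp: zero_ereal_def)
  then have "eventually (\<lambda>z. ereal \<bar>z\<bar> < fps_conv_radius F) (nhds 0)"
    by eventually_elim (simp add: in_eball_iff)
  ultimately show ?thesis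
    by (rule eventually_compose_filterlim[rotated])
qed

text \<open>Complex composition is applied to the sums of the complexified series, since
  \<open>f\<close> and \<open>g\<close> live on the reals. The resulting identity is restricted to
  the real axis, where injectivity of \<open>complex_of_real\<close> gives the real one.\<close>

lemma has_fps_expansion_compose_real:
  fixes f g :: "real \<Rightarrow> real"
  assumes F: "f has_fps_expansion F" and G: "g has_fps_expansion G" and G0: "fps_nth G 0 = 0"
  shows "(\<lambda>t. f (g t)) has_fps_expansion (F oo G)"
proof -
  let ?F = "fps_complex_of_real F" and ?G = "fps_complex_of_real G"
  have radF: "fps_conv_radius F > 0" and radG: "fps_conv_radius G > 0"
    using F G by (auto simp: has_fps_expansion_def)
  have "(eval_fps ?F \<circ> eval_fps ?G) has_fps_expansion (?F oo ?G)"
    using radF radG G0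
    by (intro has_fps_expansion_compose eval_fps_has_fps_expansion) auto
  then have rad: "fps_conv_radius (F oo G) > 0"
    and ev: "eventually (\<lambda>z. eval_fps (?F oo ?G) z = eval_fps ?F (eval_fps ?G z)) (nhds 0)"
    by (auto simp: has_fps_expansion_def simp flip: fps_complex_of_real_compose)
  have "filterlim complex_of_real (nhds (of_real 0)) (nhds 0)"
    by (intro tendsto_of_real filterlim_ident)
  then have ev': "eventually (\<lambda>t. eval_fps (?F oo ?G) (of_real t) =
      eval_fps ?F (eval_fps ?G (of_real t))) (nhds 0)"
    using eventually_compose_filterlim[OF ev] by simp
  have g0: "g 0 = 0"
    using has_fps_expansion_imp_0_eq_fps_nth_0[OF G] G0 by simp
  have contg: "isCont g 0"
    using has_fps_expansion_imp_continuous[OF G] .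
  have evF: "eventually (\<lambda>z. eval_fps F z = f z) (nhds 0)"
    and evG: "eventually (\<lambda>z. eval_fps G z = g z) (nhds 0)"
    using F G by (auto simp: has_fps_expansion_def)
  have "filterlim g (nhds 0) (nhds 0)"
    using tendsto_at_iff_tendsto_nhds[of g 0] contg g0 by (simp add: isCont_def)
  then have evF': "eventually (\<lambda>t. eval_fps F (g t) = f (g t)) (nhds 0)"
    by (rule eventually_compose_filterlim[OF evF])
  have "eventually (\<lambda>t. ereal \<bar>t\<bar> < fps_conv_radius G) (nhds 0)"
    "eventually (\<lambda>t. ereal \<bar>t\<bar> < fps_conv_radius (F oo G)) (nhds 0)"
    "eventually (\<lambda>t. ereal \<bar>g t\<bar> < fps_conv_radius F) (nhds 0)"
    using radF radG rad contg g0 by (auto intro!: eventually_abs_less_conv_radius)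
  with ev' evG evF' have "eventually (\<lambda>t. eval_fps (F oo G) t = f (g t)) (nhds 0)"
  proof eventually_elim
    case (elim t)
    have "complex_of_real (eval_fps (F oo G) t) = eval_fps (?F oo ?G) (of_real t)"
      using elim by (simp add: eval_fps_complex_of_real flip: fps_complex_of_real_compose)
    also have "\<dots> = complex_of_real (f (g t))"
      using elim by (simp add: eval_fps_complex_of_real)
    finally show ?case
      by simp
  qed
  with rad show ?thesis
    by (simp add: has_fps_expansion_def)
qed

lemma has_fps_expansion_ln1 [fps_expansion_intros]:
  "(\<lambda>t::real. ln (1 + t)) has_fps_expansion fps_ln 1"
proof (rule has_fps_expansionI)
  have "eventually (\<lambda>t::real. t \<in> ball 0 1) (nhds 0)"
    by (rule eventually_nhds_in_open) auto
  then show "eventually (\<lambda>t::real. (\<lambda>n. fps_nth (fps_ln 1) n * t ^ n) sums ln (1 + t)) (nhds 0)"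
  proof eventually_elim
    case (elim t)
    then have "(\<lambda>n. - ((- t) ^ n) / of_nat n) sums ln (1 + t)"
      by (intro ln_series') auto
    also have "(\<lambda>n. - ((- t) ^ n) / of_nat n) = (\<lambda>n. fps_nth (fps_ln 1) n * t ^ n)"
    proof
      fix n
      \<comment> \<open>At \<open>n = 0\<close> the left side is a division by 0, hence 0 by
        convention, which agrees with the constant term of \<open>fps_ln 1\<close>.\<close>
      show "- ((- t) ^ n) / of_nat n = fps_nth (fps_ln 1) n * t ^ n"
        by (cases n) (auto simp: fps_ln_nth power_minus[of t])
    qed
    finally show ?case .
  qed
qed

section \<open>Generating functions\<close>

text \<open>The exponential series may be integrated term by term because the series of absolute
  moments \<open>a m * \<bar>s\<bar> ^ m\<close> converges for small \<open>s\<close>.\<close>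

lemma mgf_has_fps_expansion:
  fixes Y :: "'a \<Rightarrow> real"
  assumes meas: "Y \<in> borel_measurable M"
    and int: "\<And>m::nat. integrable M (\<lambda>\<omega>. \<bar>Y \<omega>\<bar> ^ m)"
    and "r > 0"
    and lim: "\<And>t::real. \<bar>t\<bar> < r \<Longrightarrow>
           (\<lambda>m. \<bar>t\<bar> ^ m * (\<integral>\<omega>. \<bar>Y \<omega>\<bar> ^ m \<partial>M) / fact m) \<longlonglongrightarrow> 0"
  shows "(\<lambda>s. \<integral>\<omega>. exp (s * Y \<omega>) \<partial>M) has_fps_expansion
           Abs_fps (\<lambda>m. (\<integral>\<omega>. Y \<omega> ^ m \<partial>M) / fact m)"
proof (rule has_fps_expansionI)
  define R where "R = r / 2"
  have R: "0 < R" "R < r"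
    using \<open>r > 0\<close> by (auto simp: R_def)
  have intY: "integrable M (\<lambda>\<omega>. Y \<omega> ^ m)" for m
    by (rule Bochner_Integration.integrable_bound[OF int[of m]])
      (use meas in \<open>auto simp: power_abs\<close>)
  define a where "a m = (\<integral>\<omega>. \<bar>Y \<omega>\<bar> ^ m \<partial>M) / fact m" for m :: nat
  have "(\<lambda>m. a m * R ^ m) \<longlonglongrightarrow> 0"
    using lim[of R] R by (simp add: a_def mult.commute)
  then have "Bseq (\<lambda>m. a m * R ^ m)"
    by (intro convergent_imp_Bseq convergentI)
  then obtain B where B: "\<And>m. norm (a m * R ^ m) \<le> B"
    by (elim BseqE) blast
  \<comment> \<open>Boundedness of the terms at the radius \<open>R\<close> suffices: for smaller
    \<open>\<bar>s\<bar>\<close> they are dominated by a geometric series of ratio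
    \<open>\<bar>s\<bar> / R\<close>.\<close>
  have summ: "summable (\<lambda>m. a m * \<bar>s\<bar> ^ m)" if "\<bar>s\<bar> < R" for s
  proof (rule summable_comparison_test')
    show "summable (\<lambda>m. B * (\<bar>s\<bar> / R) ^ m)"
      using that R by (intro summable_mult summable_geometric) auto
    fix m :: nat
    have "norm (a m * \<bar>s\<bar> ^ m) = norm (a m * R ^ m) * (\<bar>s\<bar> / R) ^ m"
      using R by (simp add: abs_mult power_divide)
    also have "\<dots> \<le> B * (\<bar>s\<bar> / R) ^ m"
      using R B by (intro mult_right_mono) auto
    finally show "norm (a m * \<bar>s\<bar> ^ m) \<le> B * (\<bar>s\<bar> / R) ^ m" .
  qed
  have "eventually (\<lambda>s::real. s \<in> ball 0 R) (nhds 0)"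
    by (rule eventually_nhds_in_open) (use R in auto)
  then show "eventually (\<lambda>s. (\<lambda>m. fps_nth (Abs_fps (\<lambda>m. (\<integral>\<omega>. Y \<omega> ^ m \<partial>M) / fact m)) m * s ^ m)
      sums (\<integral>\<omega>. exp (s * Y \<omega>) \<partial>M)) (nhds 0)"
  proof eventually_elim
    case (elim s)
    let ?f = "\<lambda>m \<omega>. (s * Y \<omega>) ^ m /\<^sub>R fact m"
    have norm_f: "norm (?f m \<omega>) = \<bar>s\<bar> ^ m / fact m * \<bar>Y \<omega>\<bar> ^ m" for m \<omega>
      by (simp add: abs_mult power_abs power_mult_distrib field_simps)
    have "(\<lambda>m. \<integral>\<omega>. ?f m \<omega> \<partial>M) sums (\<integral>\<omega>. (\<Sum>m. ?f m \<omega>) \<partial>M)"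
    proof (rule sums_integral)
      show "integrable M (?f m)" for m
        using intY[of m] by (simp add: power_mult_distrib)
      show "AE \<omega> in M. summable (\<lambda>m. norm (?f m \<omega>))"
        by (intro AE_I2 summable_norm_exp)
      show "summable (\<lambda>m. \<integral>\<omega>. norm (?f m \<omega>) \<partial>M)"
        unfolding norm_f using summ[of s] elim by (simp add: a_def mult.commute)
    qed
    also have "(\<lambda>\<omega>. \<Sum>m. ?f m \<omega>) = (\<lambda>\<omega>. exp (s * Y \<omega>))"
      by (simp add: exp_def)
    also have "(\<lambda>m. \<integral>\<omega>. ?f m \<omega> \<partial>M) =
        (\<lambda>m. fps_nth (Abs_fps (\<lambda>m. (\<integral>\<omega>. Y \<omega> ^ m \<partial>M) / fact m)) m * s ^ m)"
      by (simp add: power_mult_distrib field_simps)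
    finally show ?case .
  qed
qed

lemma het_mgf_has_fps_expansion:
  fixes Y :: "'a \<Rightarrow> real"
  assumes "Y \<in> borel_measurable M"
    and "\<And>m::nat. integrable M (\<lambda>\<omega>. \<bar>Y \<omega>\<bar> ^ m)"
    and "r > 0"
    and "\<And>t::real. \<bar>t\<bar> < r \<Longrightarrow>
           (\<lambda>m. \<bar>t\<bar> ^ m * (\<integral>\<omega>. \<bar>Y \<omega>\<bar> ^ m \<partial>M) / fact m) \<longlonglongrightarrow> 0"
    and "lam \<noteq> 0"
  shows "\<exists>F. het_mgf M Y lam has_fps_expansion F"
proof -
  let ?G = "fps_const (- 1 / lam) * (fps_ln 1 oo (fps_const (- lam) * fps_X))"
  have "(\<lambda>t. - 1 / lam * ln (1 + - lam * t)) has_fps_expansion ?G"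
    by (intro has_fps_expansion_cmult_left has_fps_expansion_compose_real[OF has_fps_expansion_ln1]
        has_fps_expansion_fps_X) simp
  then have "(\<lambda>t. \<integral>\<omega>. exp (- 1 / lam * ln (1 + - lam * t) * Y \<omega>) \<partial>M) has_fps_expansion
      (Abs_fps (\<lambda>m. (\<integral>\<omega>. Y \<omega> ^ m \<partial>M) / fact m) oo ?G)"
    by (intro has_fps_expansion_compose_real[OF mgf_has_fps_expansion[OF assms(1-4)]]) simp_all
  moreover have "eventually (\<lambda>t. t \<in> ball 0 (1 / \<bar>lam\<bar>)) (nhds (0::real))"
    using assms(5) by (intro eventually_nhds_in_open) auto
  then have "eventually (\<lambda>t. (\<integral>\<omega>. exp (- 1 / lam * ln (1 + - lam * t) * Y \<omega>) \<partial>M) =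
      het_mgf M Y lam t) (nhds 0)"
  proof eventually_elim
    case (elim t)
    then have "\<bar>lam * t\<bar> < 1"
      using assms(5) by (simp add: abs_mult field_simps)
    \<comment> \<open>A nonzero base avoids the default value \<open>0 powr a = 0\<close>, so that
      \<open>powr\<close> unfolds to the exponential of a logarithm.\<close>
    then have "1 - lam * t \<noteq> 0"
      by auto
    then show ?case
      by (simp add: het_mgf_def powr_def mult.commute)
  qed
  ultimately show ?thesis
    using has_fps_expansion_cong[OF _ refl] by fast
qed

text \<open>
  Both sides satisfy the recurrence that the derivative
  \<open>A\<^sub>k' = x (k A\<^sub>k + A\<^bsub>k-1\<^esub>)\<close> of \<open>A\<^sub>k = (exp (xX) - 1)^k / k!\<close> induces on coefficients.
\<close>

lemma fps_nth_exp_minus_1_power: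
  fixes x :: "'a::field_char_0"
  shows "fps_nth ((fps_exp x - 1) ^ k) j = fact k * of_nat (Stirling j k) * x ^ j / fact j"
proof (induction j arbitrary: k)
  case 0
  show ?case
    by (cases k) (auto simp: fps_nth_power_0)
next
  case (Suc j)
  show ?case
  proof (cases k)
    case (Suc l)
    define E where "E = fps_exp x - 1"
    have "fps_deriv E = fps_const x * (E + 1)"
      by (simp add: E_def)
    then have "fps_deriv (E ^ Suc l) = fps_const (of_nat (Suc l) * x) * (E ^ Suc l + E ^ l)"
      unfolding fps_deriv_power' diff_Suc_1
      by (simp add: ring_distribs mult_ac fps_of_nat del: of_nat_Suc flip: fps_const_mult)
    then have "of_nat (Suc j) * fps_nth (E ^ Suc l) (Suc j) =
        of_nat (Suc l) * x * (fps_nth (E ^ Suc l) j + fps_nth (E ^ l) j)"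
      by (metis fps_deriv_nth fps_mult_left_const_nth fps_add_nth Suc_eq_plus1)
    \<comment> \<open>Once the factorials cancel, this is the recurrence of
      \<open>Stirling (Suc j) (Suc l)\<close>.\<close>
    also have "\<dots> = of_nat (Suc j) *
        (fact (Suc l) * of_nat (Stirling (Suc j) (Suc l)) * x ^ Suc j / fact (Suc j))"
      unfolding Suc.IH[folded E_def]
      by (simp add: field_simps del: of_nat_Suc) (simp add: algebra_simps)
    finally have "fps_nth (E ^ Suc l) (Suc j) =
        fact (Suc l) * of_nat (Stirling (Suc j) (Suc l)) * x ^ Suc j / fact (Suc j)"
      by (metis mult_left_cancel of_nat_neq_0)
    then show ?thesis
      unfolding E_def Suc .
  qed simp
qed

theorem theorem2p13:
  fixes M :: "'a measure" and Y :: "'a \<Rightarrow> real" and lam r x :: real and n k :: nat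
  assumes "prob_space M"
    and "Y \<in> borel_measurable M"
    and "\<And>m::nat. integrable M (\<lambda>\<omega>. \<bar>Y \<omega>\<bar> ^ m)"
    and "r > 0"
    and "\<And>t::real. \<bar>t\<bar> < r \<Longrightarrow>
           (\<lambda>m. \<bar>t\<bar> ^ m * (\<integral>\<omega>. \<bar>Y \<omega>\<bar> ^ m \<partial>M) / fact m) \<longlonglongrightarrow> 0"
    and "lam \<noteq> 0"
    and "k \<le> n"
  shows "partial_bell n k (\<lambda>m. het_bell M Y lam m x) =
           (\<Sum>j=k..n. real (Stirling j k) * het_stirling2 M Y lam n j * x ^ j)"
proof -
  interpret prob_space M by fact
  obtain H where H: "het_mgf M Y lam has_fps_expansion H"
    using het_mgf_has_fps_expansion[OF assms(2-6)] by blast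
  define F where "F = H - 1"
  have F: "(\<lambda>t. het_mgf M Y lam t - 1) has_fps_expansion F"
    unfolding F_def by (intro has_fps_expansion_diff H has_fps_expansion_1)
  \<comment> \<open>At \<open>t = 0\<close> the integrand is 1 and the total mass is 1. Hence
    \<open>F\<close> has no constant term, as composition with \<open>F\<close> requires.\<close>
  have "het_mgf M Y lam 0 = 1"
    by (simp add: het_mgf_def prob_space)
  then have F0: "fps_nth F 0 = 0"
    using has_fps_expansion_imp_0_eq_fps_nth_0[OF F] by simp
  have stirling: "het_stirling2 M Y lam n j = fact n * fps_nth (F ^ j) n / fact j" for j
    unfolding het_stirling2_def
    by (subst egf_coeff_eqI[OF has_fps_expansion_cmult_left[OF has_fps_expansion_power[OF F]]]) simp
  have bell: "het_bell M Y lam m x = fact m * fps_nth (fps_exp x oo F) m" for m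
    unfolding het_bell_def
    by (rule egf_coeff_eqI has_fps_expansion_compose_real[OF has_fps_expansion_exp F F0])+
  \<comment> \<open>Subtracting 1 from \<open>fps_exp x\<close> removes exactly the constant
    coefficient, matching the entry at 0 that \<open>partial_bell\<close> ignores.\<close>
  have "Abs_fps (\<lambda>m. if m = 0 then 0 else het_bell M Y lam m x / fact m) = (fps_exp x - 1) oo F"
    by (rule fps_ext) (simp add: bell fps_compose_sub_distrib)
  then have "partial_bell n k (\<lambda>m. het_bell M Y lam m x) =
      fact n / fact k * fps_nth ((fps_exp x - 1) ^ k oo F) n"
    by (simp add: partial_bell_def fps_compose_power[OF F0])
  \<comment> \<open>The factor \<open>fact k\<close> from the outer coefficient cancels the
    prefactor, and its \<open>1 / fact j\<close> turns the coefficient of \<open>F ^ j\<close> into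
    \<open>het_stirling2\<close>.\<close>
  also have "\<dots> = (\<Sum>j=0..n. real (Stirling j k) * het_stirling2 M Y lam n j * x ^ j)"
    by (simp add: fps_compose_nth fps_nth_exp_minus_1_power stirling sum_distrib_left field_simps)
  also have "\<dots> = (\<Sum>j=k..n. real (Stirling j k) * het_stirling2 M Y lam n j * x ^ j)"
    by (rule sum.mono_neutral_right) (auto simp: Stirling_less)
  finally show ?thesis .
qed

end
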